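(* Let $\zeta_0\in\mathcal X_0$ and let $\eta_0\in\{0,1\}^{\mathbb Z}$ be given by $1-2\eta_0(x)=\zeta_0(x+1)-\zeta_0(x)$ for all $x\in\mathbb Z$. Let $\zeta_t$ and $\eta_t$ be the free process and the symmetric simple exclusion process with initial configurations $\zeta_0$ and $\eta_0$, constructed from the same family of Poisson processes $(N_t(x))_{x\in\mathbb Z}$, and let $J_t$ be the integrated flux of exclusion particles through the point $-1/2$ up to time $t$. Then, almost surely, for all $t\ge0$ and $x\in\mathbb Z$, $$1-2\eta_t(x)=\zeta_t(x+1)-\zeta_t(x),$$ and furthermore $$\zeta_t(0)-\zeta_0(0)=2J_t .$$
   Context: Let $\mathcal X_0=\{\zeta\in\mathbb Z^{\mathbb Z}:|\zeta(x)-\zeta(x+1)|=1\text{ for all }x\in\mathbb Z,\ \zeta(0)\text{ even}\}$ and $\Delta\zeta(x)=\zeta(x+1)-2\zeta(x)+\zeta(x-1)$. Let $(N_t(x))_{t\ge0}$, $x\in\mathbb Z$, be independent Poisson processes of rate $\frac12$. Free process: $d\zeta_t(x)=\Delta\zeta_t(x)\,dN_t(x)$, i.e. at each event of $N(x)$ the height at $x$ is replaced by $\zeta(x)+\Delta\zeta(x)$ (computed just before the event). Exclusion process: $d\eta_t(x)=(\eta_t(x-1)-\eta_t(x))\,dN_t(x)+(\eta_t(x+1)-\eta_t(x))\,dN_t(x+1)$, i.e. at each event of $N(x)$ the values of $\eta$ at $x-1$ and $x$ are exchanged (so $N(x)$ is attached to the bond $\{x-1,x\}$). Stirring particles: for each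 $x$, $X^x_0=x$, and $X^x_t$ jumps across a bond $\{y-1,y\}$ containing its current position at each event of $N(y)$; thus $\eta_t(X^x_t)=\eta_0(x)$. Integrated flux through $-1/2$: $$J_t=\sum_{x<0}\eta_0(x)\mathbf 1\{X^x_t\ge0\}-\sum_{x\ge0}\eta_0(x)\mathbf 1\{X^x_t<0\}.$$ *)

theory Defs
  imports "HOL-Probability.Probability"
begin

text \<open>Time is \<open>real\<close>, restricted to \<open>t \<ge> 0\<close> where it matters; all state spaces below (\<open>nat\<close>, \<open>int\<close>)
  carry their discrete topology, so a cadlag path is a pure jump path with finitely many jumps in
  every bounded time interval.\<close>

definition cadlag :: "(real \<Rightarrow> 'a::t2_space) \<Rightarrow> bool" where
  "cadlag f \<longleftrightarrow> (\<forall>t\<ge>0. (f \<longlongrightarrow> f t) (at_right t)) \<and> (\<forall>t>0. \<exists>l. (f \<longlongrightarrow> l) (at_left t))"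

definition left_lim :: "(real \<Rightarrow> 'a::t2_space) \<Rightarrow> real \<Rightarrow> 'a" where
  "left_lim f t = Lim (at_left t) f"

definition poisson_process :: "'w measure \<Rightarrow> real \<Rightarrow> (real \<Rightarrow> 'w \<Rightarrow> nat) \<Rightarrow> bool" where
  "poisson_process M rate N \<longleftrightarrow>
     (\<forall>t\<ge>0. N t \<in> measurable M (count_space UNIV)) \<and>
     (AE \<omega> in M. N 0 \<omega> = 0 \<and> mono_on {0..} (\<lambda>t. N t \<omega>) \<and> cadlag (\<lambda>t. N t \<omega>)) \<and>
     (\<forall>s t. 0 \<le> s \<and> s < t \<longrightarrow>
        distr M (count_space UNIV) (\<lambda>\<omega>. N t \<omega> - N s \<omega>) = measure_pmf (poisson_pmf (rate * (t - s)))) \<and>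
     (\<forall>(\<tau> :: nat \<Rightarrow> real) n. 0 \<le> \<tau> 0 \<and> mono \<tau> \<longrightarrow>
        prob_space.indep_vars M (\<lambda>_. count_space UNIV)
          (\<lambda>i \<omega>. N (\<tau> (Suc i)) \<omega> - N (\<tau> i) \<omega>) {..<n})"

text \<open>Independence of the processes is independence of their paths, as random elements of the
  product space of all functions on \<open>{0..}\<close>.\<close>

definition indep_poisson_processes ::
    "'w measure \<Rightarrow> real \<Rightarrow> ('i \<Rightarrow> real \<Rightarrow> 'w \<Rightarrow> nat) \<Rightarrow> bool" where
  "indep_poisson_processes M rate N \<longleftrightarrow>
     (\<forall>x. poisson_process M rate (N x)) \<and>
     prob_space.indep_vars M (\<lambda>_. PiM {0..} (\<lambda>_. count_space UNIV))
       (\<lambda>x \<omega>. \<lambda>t\<in>{0..}. N x t \<omega>) UNIV"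

definition event :: "(real \<Rightarrow> nat) \<Rightarrow> real \<Rightarrow> bool" where
  "event n t \<longleftrightarrow> 0 < t \<and> left_lim n t \<noteq> n t"

definition X0 :: "(int \<Rightarrow> int) set" where
  "X0 = {\<zeta>. (\<forall>x. \<bar>\<zeta> x - \<zeta> (x + 1)\<bar> = 1) \<and> even (\<zeta> 0)}"

definition lap :: "(int \<Rightarrow> int) \<Rightarrow> int \<Rightarrow> int" where
  "lap \<zeta> x = \<zeta> (x + 1) - 2 * \<zeta> x + \<zeta> (x - 1)"

text \<open>The three dynamics are stated path by path: \<open>n x\<close> is the path of the clock at \<open>x\<close>. A cadlag
  path in a discrete space is determined by its initial value and its jumps, so prescribing the
  jump at every time \<open>t > 0\<close> (possibly zero) is the meaning of the driven equations.\<close>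

definition free_process :: "(int \<Rightarrow> real \<Rightarrow> nat) \<Rightarrow> (int \<Rightarrow> int) \<Rightarrow> (real \<Rightarrow> int \<Rightarrow> int) \<Rightarrow> bool" where
  "free_process n \<zeta>0 \<zeta> \<longleftrightarrow>
     \<zeta> 0 = \<zeta>0 \<and>
     (\<forall>x. cadlag (\<lambda>t. \<zeta> t x)) \<and>
     (\<forall>t>0. \<forall>x. let \<zeta>' = (\<lambda>y. left_lim (\<lambda>s. \<zeta> s y) t) in
        \<zeta> t x - \<zeta>' x = lap \<zeta>' x * of_bool (event (n x) t))"

definition exclusion_process ::
    "(int \<Rightarrow> real \<Rightarrow> nat) \<Rightarrow> (int \<Rightarrow> int) \<Rightarrow> (real \<Rightarrow> int \<Rightarrow> int) \<Rightarrow> bool" where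
  "exclusion_process n \<eta>0 \<eta> \<longleftrightarrow>
     \<eta> 0 = \<eta>0 \<and>
     (\<forall>x. cadlag (\<lambda>t. \<eta> t x)) \<and>
     (\<forall>t>0. \<forall>x. let \<eta>' = (\<lambda>y. left_lim (\<lambda>s. \<eta> s y) t) in
        \<eta> t x - \<eta>' x = (\<eta>' (x - 1) - \<eta>' x) * of_bool (event (n x) t)
                     + (\<eta>' (x + 1) - \<eta>' x) * of_bool (event (n (x + 1)) t))"

text \<open>A particle at \<open>y\<close> sits on the bonds \<open>{y - 1, y}\<close> (clock \<open>y\<close>) and \<open>{y, y + 1}\<close>
  (clock \<open>y + 1\<close>). Simultaneous events of the two clocks have probability zero.\<close>

definition stirring_path :: "(int \<Rightarrow> real \<Rightarrow> nat) \<Rightarrow> int \<Rightarrow> (real \<Rightarrow> int) \<Rightarrow> bool" where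
  "stirring_path n x X \<longleftrightarrow>
     X 0 = x \<and>
     cadlag X \<and>
     (\<forall>t>0. let y = left_lim X t in
        X t - y = of_bool (event (n (y + 1)) t) - of_bool (event (n y) t))"

text \<open>\<open>X x t\<close> is the position at time \<open>t\<close> of the stirring particle started from \<open>x\<close>. As \<open>infsum\<close>
  is \<open>0\<close> for divergent sums, the convergence of both sums (in \<open>int\<close>: finitely many nonzero terms)
  is recorded separately.\<close>

definition flux :: "(int \<Rightarrow> int) \<Rightarrow> (int \<Rightarrow> real \<Rightarrow> int) \<Rightarrow> real \<Rightarrow> int" where
  "flux \<eta>0 X t =
     (\<Sum>\<^sub>\<infinity>x\<in>{..<0}. \<eta>0 x * of_bool (X x t \<ge> 0)) - (\<Sum>\<^sub>\<infinity>x\<in>{0..}. \<eta>0 x * of_bool (X x t < 0))"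

definition flux_converges :: "(int \<Rightarrow> int) \<Rightarrow> (int \<Rightarrow> real \<Rightarrow> int) \<Rightarrow> real \<Rightarrow> bool" where
  "flux_converges \<eta>0 X t \<longleftrightarrow>
     (\<lambda>x. \<eta>0 x * of_bool (X x t \<ge> 0)) summable_on {..<0} \<and>
     (\<lambda>x. \<eta>0 x * of_bool (X x t < 0)) summable_on {0..}"

end

theory Submission
  imports Defs
begin

text \<open>Almost surely no two clocks ring simultaneously, and for every \<open>T\<close> there are clocks arbitrarily
  far to the left and to the right that do not ring before \<open>T\<close>. Such silent clocks \<open>a\<close> and \<open>b\<close>
  isolate the finite block \<open>{a..<b}\<close>, on which a property of the cadlag paths holds throughout
  \<open>[0, T]\<close> if it holds initially and is preserved by each jump; in this way the events need not be
  enumerated. The discrete gradient of the free process and \<open>1 - 2 \<eta>\<close> satisfy the same driven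
  equation. The stirring particles permute the block and carry the values of \<open>\<eta>\<close> with them, so
  the flux is the change of the sum of \<open>\<eta>\<close> over \<open>{0..<b}\<close>. Telescoping the gradient over
  \<open>{0..<b}\<close>, where the height at \<open>b\<close> is constant, turns this into the height change at \<open>0\<close>.\<close>

section \<open>Invariants of cadlag paths in discrete spaces\<close>

text \<open>Let \<open>m\<close> be the infimum of the failures. \<open>Q\<close> holds below
  \<open>m\<close>, so \<open>left\<close> (or \<open>Q 0\<close>) gives \<open>Q m\<close>, and
  \<open>right\<close> then carries \<open>Q\<close> beyond \<open>m\<close>, which contradicts the
  choice of \<open>m\<close>.\<close>

lemma real_interval_induct:
  fixes Q :: "real \<Rightarrow> bool"
  assumes "Q 0"
    and right: "\<And>t. 0 \<le> t \<Longrightarrow> t < T \<Longrightarrow> Q t \<Longrightarrow> eventually Q (at_right t)"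
    and left: "\<And>t. 0 < t \<Longrightarrow> t \<le> T \<Longrightarrow> eventually Q (at_left t) \<Longrightarrow> Q t"
    and t: "0 \<le> t" "t \<le> T"
  shows "Q t"
proof (rule ccontr)
  assume nQ: "\<not> Q t"
  define S where "S = {s. 0 \<le> s \<and> s \<le> T \<and> \<not> Q s}"
  define m where "m = Inf S"
  have tS: "t \<in> S" using nQ t by (simp add: S_def)
  have bdd: "bdd_below S" by (rule bdd_belowI[of _ 0]) (simp add: S_def)
  have m0: "0 \<le> m" unfolding m_def using tS by (intro cInf_greatest) (auto simp: S_def)
  have mt: "m \<le> t" unfolding m_def using tS bdd by (rule cInf_lower)
  have below: "Q s" if "0 \<le> s" "s < m" for s
  proof (rule ccontr)
    assume "\<not> Q s"
    then have "s \<in> S" using that mt t by (simp add: S_def)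
    then have "m \<le> s" unfolding m_def using bdd by (intro cInf_lower)
    then show False using that by simp
  qed
  have Qm: "Q m"
  proof (cases "m = 0")
    case False
    then have "m > 0" using m0 by simp
    moreover have "eventually Q (at_left m)"
      using eventually_at_left_real[OF \<open>m > 0\<close>] by eventually_elim (auto intro: below)
    ultimately show ?thesis using left mt t by auto
  qed (use \<open>Q 0\<close> in simp)
  then have "m < t" using nQ mt by (cases "m = t") auto
  then have "eventually Q (at_right m)" using right[OF m0 _ Qm] t by simp
  then obtain b where b: "b > m" "\<And>y. m < y \<Longrightarrow> y < b \<Longrightarrow> Q y"
    unfolding eventually_at_right_field by blast
  have "b \<le> s" if "s \<in> S" for s
  proof -
    have "m \<le> s" unfolding m_def using that bdd by (rule cInf_lower)
    moreover have "\<not> Q s" using that by (simp add: S_def)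
    ultimately show ?thesis using b(2)[of s] Qm by (cases "m = s") force+
  qed
  then have "b \<le> m" unfolding m_def using tS by (intro cInf_greatest) auto
  then show False using b(1) by simp
qed

lemma cadlag_eventually_right:
  fixes f :: "real \<Rightarrow> 'a::{discrete_topology, t2_space}"
  assumes "cadlag f" "0 \<le> t"
  shows "\<forall>\<^sub>F s in at_right t. f s = f t"
  using assms unfolding cadlag_def by (auto simp: tendsto_discrete)

lemma cadlag_eventually_left:
  fixes f :: "real \<Rightarrow> 'a::{discrete_topology, t2_space}"
  assumes "cadlag f" "0 < t"
  shows "\<forall>\<^sub>F s in at_left t. f s = left_lim f t"
proof -
  obtain l where l: "(f \<longlongrightarrow> l) (at_left t)" using assms unfolding cadlag_def by blast
  \<comment> \<open>\<open>Lim\<close> is a definite description; the existence of \<open>l\<close>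
    and the uniqueness of limits make it the actual limit.\<close>
  then have "left_lim f t = l" unfolding left_lim_def by (intro tendsto_Lim) auto
  then show ?thesis using l by (simp add: tendsto_discrete)
qed

text \<open>Finitely many discrete cadlag paths are jointly constant just after \<open>t\<close> and
  jointly equal to their left limits just before \<open>t\<close>. Hence \<open>local\<close>:
  \<open>P\<close> may read only the coordinates in the finite set \<open>B\<close>. Interval
  induction then leaves only the jumps to check.\<close>

lemma cadlag_invariant:
  fixes Y :: "'i \<Rightarrow> real \<Rightarrow> 'a::{discrete_topology, t2_space}"
  assumes "finite B"
    and cad: "\<And>i. i \<in> B \<Longrightarrow> cadlag (Y i)"
    and local: "\<And>f g. (\<And>i. i \<in> B \<Longrightarrow> f i = g i) \<Longrightarrow> P f \<Longrightarrow> P g"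
    and init: "P (\<lambda>i. Y i 0)"
    and jump: "\<And>t. 0 < t \<Longrightarrow> t \<le> T \<Longrightarrow> P (\<lambda>i. left_lim (Y i) t) \<Longrightarrow> P (\<lambda>i. Y i t)"
    and t: "0 \<le> t" "t \<le> T"
  shows "P (\<lambda>i. Y i t)"
proof (rule real_interval_induct[where Q = "\<lambda>t. P (\<lambda>i. Y i t)", OF init _ _ t])
  fix t :: real assume t: "0 \<le> t" "P (\<lambda>i. Y i t)"
  have "\<forall>\<^sub>F s in at_right t. \<forall>i\<in>B. Y i s = Y i t"
    using cadlag_eventually_right[OF cad t(1)] by (intro eventually_ball_finite \<open>finite B\<close>) blast
  then show "\<forall>\<^sub>F s in at_right t. P (\<lambda>i. Y i s)"
  proof eventually_elim
    case (elim s)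
    show ?case by (rule local[OF _ t(2)]) (use elim in simp)
  qed
next
  fix t :: real assume t: "0 < t" "t \<le> T" and ev: "\<forall>\<^sub>F s in at_left t. P (\<lambda>i. Y i s)"
  have "\<forall>\<^sub>F s in at_left t. \<forall>i\<in>B. Y i s = left_lim (Y i) t"
    using cadlag_eventually_left[OF cad t(1)] by (intro eventually_ball_finite \<open>finite B\<close>) blast
  then have "\<forall>\<^sub>F s in at_left t. P (\<lambda>i. left_lim (Y i) t)" using ev
  proof eventually_elim
    case (elim s)
    show ?case by (rule local[OF _ elim(2)]) (use elim(1) in simp)
  qed
  \<comment> \<open>The statement does not mention \<open>s\<close>, and \<open>at_left t\<close> is
    a nontrivial filter.\<close>
  then have "P (\<lambda>i. left_lim (Y i) t)" by simp
  then show "P (\<lambda>i. Y i t)" using jump t by blast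
qed

section \<open>Dynamics between silent clocks\<close>

definition silent :: "(real \<Rightarrow> nat) \<Rightarrow> real \<Rightarrow> bool" where
  "silent c T \<longleftrightarrow> (\<forall>t. 0 < t \<and> t \<le> T \<longrightarrow> \<not> event c t)"

lemma silent_mono: "silent c T \<Longrightarrow> t \<le> T \<Longrightarrow> silent c t"
  by (auto simp: silent_def)

text \<open>Both jumps are linear in the event indicators of the clocks \<open>x\<close> and
  \<open>x + 1\<close>, so they are matched indicator by indicator. The silent clocks at the ends
  remove the terms that would read values outside the block.\<close>

lemma free_exclusion_gradient:
  assumes fp: "free_process n \<zeta>0 \<zeta>" and ep: "exclusion_process n \<eta>0 \<eta>"
    and init: "\<forall>x. 1 - 2 * \<eta>0 x = \<zeta>0 (x + 1) - \<zeta>0 x"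
    and a: "silent (n a) T" and b: "silent (n b) T"
    and x: "a \<le> x" "x < b" and t: "0 \<le> t" "t \<le> T"
  shows "1 - 2 * \<eta> t x = \<zeta> t (x + 1) - \<zeta> t x"
proof -
  \<comment> \<open>The sum type turns heights and occupation values into one family. Heights are
    read on \<open>{a..b}\<close>, one site more than the values, because the gradient at
    \<open>b - 1\<close> uses the height at \<open>b\<close>.\<close>
  define Y :: "int + int \<Rightarrow> real \<Rightarrow> int" where
    "Y = (\<lambda>i s. case i of Inl y \<Rightarrow> \<zeta> s y | Inr y \<Rightarrow> \<eta> s y)"
  define P :: "(int + int \<Rightarrow> int) \<Rightarrow> bool" where
    "P = (\<lambda>f. \<forall>x\<in>{a..<b}. 1 - 2 * f (Inr x) = f (Inl (x + 1)) - f (Inl x))"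
  have Yl: "Y (Inl y) = (\<lambda>s. \<zeta> s y)" and Yr: "Y (Inr y) = (\<lambda>s. \<eta> s y)" for y
    by (simp_all add: Y_def)
  have "P (\<lambda>i. Y i t)"
  proof (rule cadlag_invariant[where Y = Y and P = P and B = "Inl ` {a..b} \<union> Inr ` {a..<b}", OF _ _ _ _ _ t])
    show "cadlag (Y i)" for i
      using fp ep by (cases i) (auto simp: Yl Yr free_process_def exclusion_process_def)
    show "P g" if "\<And>i. i \<in> Inl ` {a..b} \<union> Inr ` {a..<b} \<Longrightarrow> f i = g i" "P f" for f g
      unfolding P_def
    proof
      fix x assume x: "x \<in> {a..<b}"
      then have "f (Inl x) = g (Inl x)" "f (Inl (x + 1)) = g (Inl (x + 1))" "f (Inr x) = g (Inr x)"
        using that(1) by auto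
      then show "1 - 2 * g (Inr x) = g (Inl (x + 1)) - g (Inl x)"
        using bspec[OF that(2)[unfolded P_def] x] by simp
    qed
    show "P (\<lambda>i. Y i 0)"
      using fp ep init by (auto simp: P_def Yl Yr free_process_def exclusion_process_def)
    fix t :: real assume t: "0 < t" "t \<le> T" and "P (\<lambda>i. left_lim (Y i) t)"
    define z h where "z = (\<lambda>y. left_lim (\<lambda>s. \<zeta> s y) t)" and "h = (\<lambda>y. left_lim (\<lambda>s. \<eta> s y) t)"
    have grad: "1 - 2 * h x = z (x + 1) - z x" if "a \<le> x" "x < b" for x
      using \<open>P (\<lambda>i. left_lim (Y i) t)\<close> that by (auto simp: P_def Yl Yr z_def h_def)
    have z: "\<zeta> t x = z x + lap z x * of_bool (event (n x) t)" for x
      using fp t by (auto simp: free_process_def z_def Let_def algebra_simps)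
    have h: "\<eta> t x = h x + (h (x - 1) - h x) * of_bool (event (n x) t)
                     + (h (x + 1) - h x) * of_bool (event (n (x + 1)) t)" for x
    proof -
      have "\<eta> t x - h x = (h (x - 1) - h x) * of_bool (event (n x) t)
                     + (h (x + 1) - h x) * of_bool (event (n (x + 1)) t)"
        using ep t by (simp add: exclusion_process_def h_def Let_def)
      then show ?thesis by linarith
    qed
    show "P (\<lambda>i. Y i t)"
      unfolding P_def Yl Yr
    proof
      fix x assume x: "x \<in> {a..<b}"
      have left: "lap z x * of_bool (event (n x) t) = 2 * (h (x - 1) - h x) * of_bool (event (n x) t)"
      proof (cases "x = a")
        case True
        then show ?thesis using a t by (auto simp: silent_def)
      next
        case False
        then show ?thesis using grad[of "x - 1"] grad[of x] x
          by (auto simp: lap_def)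
      qed
      have right: "lap z (x + 1) * of_bool (event (n (x + 1)) t)
          = 2 * (h x - h (x + 1)) * of_bool (event (n (x + 1)) t)"
      proof (cases "x + 1 = b")
        case True
        then show ?thesis using b t by (auto simp: silent_def)
      next
        case False
        then show ?thesis using grad[of "x + 1"] grad[of x] x
          by (auto simp: lap_def)
      qed
      show "1 - 2 * \<eta> t x = \<zeta> t (x + 1) - \<zeta> t x"
        unfolding z h left right using grad[of x] x by (simp add: algebra_simps)
    qed
  qed auto
  then show ?thesis using x by (simp add: P_def Yl Yr)
qed

text \<open>A height moves only with its own clock, so one silent clock freezes it. This anchors the
  telescoping sum at its right end.\<close>

lemma free_process_silent:
  assumes "free_process n \<zeta>0 \<zeta>" "silent (n b) T" "0 \<le> t" "t \<le> T"
  shows "\<zeta> t b = \<zeta>0 b"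
proof (rule cadlag_invariant[where Y = "\<lambda>_::unit. \<lambda>s. \<zeta> s b" and B = UNIV and P = "\<lambda>f. f () = \<zeta>0 b",
      OF _ _ _ _ _ assms(3,4)])
  show "cadlag (\<lambda>s. \<zeta> s b)" "\<zeta> 0 b = \<zeta>0 b" using assms(1) by (auto simp: free_process_def)
  fix t assume t: "0 < t" "t \<le> T" "left_lim (\<lambda>s. \<zeta> s b) t = \<zeta>0 b"
  then have "\<not> event (n b) t" using assms(2) by (simp add: silent_def)
  moreover have "\<zeta> t b - left_lim (\<lambda>s. \<zeta> s b) t
      = lap (\<lambda>y. left_lim (\<lambda>s. \<zeta> s y) t) b * of_bool (event (n b) t)"
    using assms(1) t(1) by (simp add: free_process_def Let_def)
  ultimately show "\<zeta> t b = \<zeta>0 b" using t(3) by simp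
qed auto

section \<open>Stirring particles: confinement, injectivity and transported values\<close>

lemma stirring_path_jump:
  assumes "stirring_path n x X" "0 < t"
  shows "X t = left_lim X t + of_bool (event (n (left_lim X t + 1)) t) - of_bool (event (n (left_lim X t)) t)"
  using assms unfolding stirring_path_def Let_def by (metis add.commute add_diff_eq diff_add_cancel)

text \<open>The bond \<open>{c - 1, c}\<close> is crossed only at events of clock \<open>c\<close>,
  and a jump moves a particle by at most one site.\<close>

lemma stirring_path_barrier:
  assumes X: "stirring_path n x X" and c: "silent (n c) T" and t: "0 \<le> t" "t \<le> T"
  shows "X t < c \<longleftrightarrow> x < c"
proof (rule cadlag_invariant[where Y = "\<lambda>_::unit. X" and B = UNIV and P = "\<lambda>f. f () < c \<longleftrightarrow> x < c",
      OF _ _ _ _ _ t])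
  show "cadlag X" "X 0 < c \<longleftrightarrow> x < c" using X by (auto simp: stirring_path_def)
  fix t assume t: "0 < t" "t \<le> T" "left_lim X t < c \<longleftrightarrow> x < c"
  have "\<not> event (n c) t" using c t by (simp add: silent_def)
  then show "X t < c \<longleftrightarrow> x < c"
    using t(3) stirring_path_jump[OF X t(1)]
    by (cases "left_lim X t = c"; cases "left_lim X t + 1 = c") (auto simp: of_bool_def split: if_splits)
qed auto

text \<open>At each time all particles are moved by the same map of the sites. It exchanges the ends
  of disjoint bonds, so it is an involution and keeps distinct positions distinct.\<close>

lemma stirring_paths_distinct:
  assumes X: "stirring_path n x X" and X': "stirring_path n x' X'" and "x \<noteq> x'" "0 \<le> t"
    and simult: "\<forall>t>0. \<forall>y. \<not> (event (n y) t \<and> event (n (y + 1)) t)"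
  shows "X t \<noteq> X' t"
proof (rule cadlag_invariant[where Y = "\<lambda>i. if i then X else X'" and B = UNIV
      and P = "\<lambda>f. f True \<noteq> f False", OF _ _ _ _ _ \<open>0 \<le> t\<close> order_refl, simplified])
  show "cadlag (if i then X else X')" for i using X X' by (auto simp: stirring_path_def)
  show "X 0 \<noteq> X' 0" using X X' \<open>x \<noteq> x'\<close> by (auto simp: stirring_path_def)
  fix s assume s: "0 < s" "left_lim X s \<noteq> left_lim X' s"
  define \<sigma> where "\<sigma> = (\<lambda>y. y + of_bool (event (n (y + 1)) s) - of_bool (event (n y) s))"
  \<comment> \<open>Injectivity of \<open>\<sigma>\<close> fails if the clocks \<open>y\<close> and \<open>y + 1\<close> ring simultaneously.\<close>
  have "\<sigma> (\<sigma> y) = y" for y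
    using simult[rule_format, OF s(1), of y] simult[rule_format, OF s(1), of "y + 1"]
      simult[rule_format, OF s(1), of "y - 1"]
    by (cases "event (n (y + 1)) s"; cases "event (n y) s") (auto simp: \<sigma>_def)
  then have "\<sigma> (left_lim X s) \<noteq> \<sigma> (left_lim X' s)" using s(2) by metis
  then show "X s \<noteq> X' s"
    using stirring_path_jump[OF X s(1)] stirring_path_jump[OF X' s(1)] by (simp add: \<sigma>_def)
qed

text \<open>The event that moves the particle exchanges the values at the two ends of the crossed
  bond, and no exchange on an adjacent bond occurs at the same time.\<close>

lemma exclusion_follows_stirring:
  assumes ep: "exclusion_process n \<eta>0 \<eta>" and X: "stirring_path n x X"
    and simult: "\<forall>t>0. \<forall>y. \<not> (event (n y) t \<and> event (n (y + 1)) t)"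
    and a: "silent (n a) T" and b: "silent (n b) T"
    and x: "a \<le> x" "x < b" and t: "0 \<le> t" "t \<le> T"
  shows "\<eta> t (X t) = \<eta>0 x"
proof -
  define Y :: "int option \<Rightarrow> real \<Rightarrow> int" where
    "Y = (\<lambda>i s. case i of None \<Rightarrow> X s | Some y \<Rightarrow> \<eta> s y)"
  have Yn: "Y None = X" and Ys: "Y (Some y) = (\<lambda>s. \<eta> s y)" for y
    by (simp_all add: Y_def)
  \<comment> \<open>The value is read at the moving position \<open>f None\<close>. Keeping this
    position in the block is what makes \<open>P\<close> depend on finitely many
    coordinates.\<close>
  define P :: "(int option \<Rightarrow> int) \<Rightarrow> bool" where
    "P = (\<lambda>f. f None \<in> {a..<b} \<and> f (Some (f None)) = \<eta>0 x)"
  have "P (\<lambda>i. Y i t)"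
  proof (rule cadlag_invariant[where Y = Y and P = P and B = "insert None (Some ` {a..<b})", OF _ _ _ _ _ t])
    show "cadlag (Y i)" for i
      using X ep by (cases i) (auto simp: Yn Ys stirring_path_def exclusion_process_def)
    show "P g" if "\<And>i. i \<in> insert None (Some ` {a..<b}) \<Longrightarrow> f i = g i" "P f" for f g
      using that(2) that(1)[of None] that(1)[of "Some (f None)"] by (auto simp: P_def)
    show "P (\<lambda>i. Y i 0)"
      using x X ep by (auto simp: P_def Yn Ys stirring_path_def exclusion_process_def)
    fix t :: real assume t: "0 < t" "t \<le> T" and IH: "P (\<lambda>i. left_lim (Y i) t)"
    define h where "h = (\<lambda>y. left_lim (\<lambda>s. \<eta> s y) t)"
    define y where "y = left_lim X t"
    have hy: "h y = \<eta>0 x" using IH by (simp add: P_def Yn Ys h_def y_def)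
    have h: "\<eta> t u - h u = (h (u - 1) - h u) * of_bool (event (n u) t)
                     + (h (u + 1) - h u) * of_bool (event (n (u + 1)) t)" for u
      using ep t by (simp add: exclusion_process_def h_def Let_def)
    have Xt: "X t = y + of_bool (event (n (y + 1)) t) - of_bool (event (n y) t)"
      unfolding y_def by (rule stirring_path_jump[OF X t(1)])
    \<comment> \<open>Clocks \<open>y\<close> and \<open>y + 1\<close> do not ring together. After a
      jump to \<open>y + 1\<close> only clock \<open>y + 2\<close> could disturb the transported
      value, after a jump to \<open>y - 1\<close> only clock \<open>y - 1\<close>; the three
      instances of \<open>simult\<close> exclude all this.\<close>
    have "\<eta> t (X t) = \<eta>0 x"
      using simult[rule_format, OF t(1), of y] simult[rule_format, OF t(1), of "y + 1"] simult[rule_format, OF t(1), of "y - 1"]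
        h[of y] h[of "y + 1"] h[of "y - 1"] hy
      unfolding Xt by (cases "event (n (y + 1)) t"; cases "event (n y) t") auto
    moreover have "X t \<in> {a..<b}"
      using stirring_path_barrier[OF X a, of t] stirring_path_barrier[OF X b, of t] t x by auto
    ultimately show "P (\<lambda>i. Y i t)" by (simp add: P_def Yn Ys)
  qed auto
  then show ?thesis by (simp add: P_def Yn Ys)
qed

section \<open>The flux as a change of occupation sums and as a height difference\<close>

lemma flux_between_silent_clocks:
  assumes fp: "free_process n \<zeta>0 \<zeta>" and ep: "exclusion_process n \<eta>0 \<eta>"
    and X: "\<And>x. stirring_path n x (X x)"
    and simult: "\<forall>t>0. \<forall>y. \<not> (event (n y) t \<and> event (n (y + 1)) t)"
    and init: "\<forall>x. 1 - 2 * \<eta>0 x = \<zeta>0 (x + 1) - \<zeta>0 x"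
    and a: "silent (n a) T" "a \<le> 0" and b: "silent (n b) T" "0 \<le> b"
    and t: "0 \<le> t" "t \<le> T"
  shows "flux_converges \<eta>0 X t" "\<zeta> t 0 - \<zeta>0 0 = 2 * flux \<eta>0 X t"
proof -
  have bar_a: "X x t < a \<longleftrightarrow> x < a" and bar_b: "X x t < b \<longleftrightarrow> x < b" for x
    using stirring_path_barrier[OF X a(1) t] stirring_path_barrier[OF X b(1) t] by auto
  define fl fr where "fl = (\<lambda>x. \<eta>0 x * of_bool (X x t \<ge> 0))" and "fr = (\<lambda>x. \<eta>0 x * of_bool (X x t < 0))"
  \<comment> \<open>As \<open>a \<le> 0 \<le> b\<close>, a particle from outside the block cannot
    change sides of the origin, so both sums reduce to finite ones.\<close>
  have fl0: "fl x = 0" if "x \<in> {..<0} - {a..<0}" for x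
    using that bar_a[of x] a(2) by (auto simp: fl_def)
  have fr0: "fr x = 0" if "x \<in> {0..} - {0..<b}" for x
    using that bar_b[of x] b(2) by (auto simp: fr_def)
  have "fl summable_on {..<0} \<longleftrightarrow> fl summable_on {a..<0}"
    by (rule summable_on_cong_neutral) (use fl0 in auto)
  moreover have "fr summable_on {0..} \<longleftrightarrow> fr summable_on {0..<b}"
    by (rule summable_on_cong_neutral) (use fr0 in auto)
  ultimately show "flux_converges \<eta>0 X t"
    by (simp add: flux_converges_def fl_def fr_def)
  have "infsum fl {..<0} = infsum fl {a..<0}"
    by (rule infsum_cong_neutral) (use fl0 in auto)
  moreover have "infsum fr {0..} = infsum fr {0..<b}"
    by (rule infsum_cong_neutral) (use fr0 in auto)
  ultimately have "flux \<eta>0 X t = sum fl {a..<0} - sum fr {0..<b}"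
    by (simp add: flux_def fl_def fr_def)
  \<comment> \<open>The values that start in \<open>{0..<b}\<close> are split by the side on which
    they end. The flux thus becomes what ends at nonnegative sites minus what started there.\<close>
  moreover have "sum fr {0..<b} = sum \<eta>0 {0..<b} - sum fl {0..<b}"
    unfolding sum_subtractf[symmetric] by (rule sum.cong) (auto simp: fr_def fl_def)
  moreover have "sum fl {a..<b} = sum fl {a..<0} + sum fl {0..<b}"
    using a(2) b(2) by (subst sum.union_disjoint[symmetric]) (auto intro: sum.cong)
  ultimately have flux: "flux \<eta>0 X t = sum fl {a..<b} - sum \<eta>0 {0..<b}" by simp
  have inj: "inj_on (\<lambda>x. X x t) {a..<b}"
    using stirring_paths_distinct[OF X X _ t(1) simult] by (meson inj_onI)
  have "(\<lambda>x. X x t) ` {a..<b} \<subseteq> {a..<b}" using bar_a bar_b by (auto simp: not_less[symmetric])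
  \<comment> \<open>An injective map of a finite set into itself is onto, so the sum can be
    reindexed by final positions.\<close>
  then have img: "(\<lambda>x. X x t) ` {a..<b} = {a..<b}"
    using inj by (intro endo_inj_surj) auto
  have "sum fl {a..<b} = (\<Sum>x\<in>{a..<b}. \<eta> t (X x t) * of_bool (X x t \<ge> 0))"
    unfolding fl_def
    using exclusion_follows_stirring[OF ep X simult a(1) b(1) _ _ t]
    by (intro sum.cong) auto
  also have "\<dots> = (\<Sum>y\<in>{a..<b}. \<eta> t y * of_bool (y \<ge> 0))"
    using sum.reindex[OF inj, of "\<lambda>y. \<eta> t y * of_bool (y \<ge> 0)"] img by simp
  also have "\<dots> = sum (\<eta> t) {0..<b}"
    using a(2) by (intro sum.mono_neutral_cong_right) auto
  finally have flux': "flux \<eta>0 X t = sum (\<eta> t) {0..<b} - sum \<eta>0 {0..<b}" using flux by simp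
  \<comment> \<open>Kept general in \<open>h\<close> and \<open>z\<close> so that it applies both at
    time \<open>t\<close> and at time 0.\<close>
  have tele: "2 * sum h {0..<b} = b - z b + z 0" if "\<And>x. 0 \<le> x \<Longrightarrow> x < b \<Longrightarrow> 1 - 2 * h x = z (x + 1) - z x"
    for h z :: "int \<Rightarrow> int"
  proof -
    have "2 * sum h {0..<c} = c - z c + z 0" if "0 \<le> c" "c \<le> b" for c
      using that
    proof (induction c rule: int_ge_induct)
      case (step i)
      have "{0..<i + 1} = insert i {0..<i}" using step by auto
      then show ?case using step \<open>\<And>x. 0 \<le> x \<Longrightarrow> x < b \<Longrightarrow> 1 - 2 * h x = z (x + 1) - z x\<close>[of i]
        by (simp add: algebra_simps)
    qed simp
    then show ?thesis using b(2) by simp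
  qed
  have "2 * sum (\<eta> t) {0..<b} = b - \<zeta> t b + \<zeta> t 0"
    by (rule tele) (use free_exclusion_gradient[OF fp ep init a(1) b(1) _ _ t] a(2) in auto)
  moreover have "2 * sum \<eta>0 {0..<b} = b - \<zeta>0 b + \<zeta>0 0" using init by (intro tele) blast
  moreover have "\<zeta> t b = \<zeta>0 b" by (rule free_process_silent[OF fp b(1) t])
  ultimately show "\<zeta> t 0 - \<zeta>0 0 = 2 * flux \<eta>0 X t" using flux' by simp
qed

section \<open>Almost sure properties of the clocks\<close>

text \<open>The left limit is attained at some \<open>v\<close> strictly between \<open>s\<close>
  and \<open>t\<close>, and monotonicity turns the inequality of \<open>n v\<close> and
  \<open>n t\<close> into a strict increase. The event may sit at the right end \<open>u\<close>,
  but not at \<open>s\<close>.\<close>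

lemma event_imp_increment:
  assumes mono: "mono_on {0..} n" and cad: "cadlag n" and ev: "event n t" and "0 \<le> s" "s < t" "t \<le> u"
  shows "n s < n u"
proof -
  have "0 < t" and ne: "left_lim n t \<noteq> n t" using ev by (auto simp: event_def)
  have "\<forall>\<^sub>F v in at_left t. n v = left_lim n t \<and> v \<in> {s<..<t}"
    using cadlag_eventually_left[OF cad \<open>0 < t\<close>] eventually_at_left_real[OF \<open>s < t\<close>]
    by (rule eventually_conj)
  then obtain v where v: "n v = left_lim n t" "s < v" "v < t"
    using eventually_happens[of _ "at_left t"] by force
  have "n s \<le> n v" "n v \<le> n t" "n t \<le> n u"
    using v(2,3) assms(4-6) by (intro mono_onD[OF mono]; simp)+
  then show ?thesis using ne v(1) by linarith
qed

lemma measurable_diff_count_space: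
  fixes f g :: "'a \<Rightarrow> 'b::{countable, minus}"
  assumes [measurable]: "f \<in> measurable M (count_space UNIV)" "g \<in> measurable M (count_space UNIV)"
  shows "(\<lambda>x. f x - g x) \<in> measurable M (count_space UNIV)"
  by measurable

section \<open>Increments of independent Poisson processes\<close>

context prob_space
begin

lemma poisson_increment_measurable:
  assumes "poisson_process M r N" "0 \<le> s" "0 \<le> t"
  shows "(\<lambda>\<omega>. N t \<omega> - N s \<omega>) \<in> measurable M (count_space (UNIV :: nat set))"
  using assms by (intro measurable_diff_count_space) (auto simp: poisson_process_def)

lemma prob_poisson_no_increment:
  assumes N: "poisson_process M r N" and "0 < r" "0 \<le> s" "s < t"
  shows "prob ((\<lambda>\<omega>. N t \<omega> - N s \<omega>) -` {0} \<inter> space M) = exp (- (r * (t - s)))"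
proof -
  have "prob ((\<lambda>\<omega>. N t \<omega> - N s \<omega>) -` {0} \<inter> space M)
      = measure (distr M (count_space UNIV) (\<lambda>\<omega>. N t \<omega> - N s \<omega>)) {0}"
    using poisson_increment_measurable[OF N, of s t] assms by (subst measure_distr) auto
  also have "distr M (count_space UNIV) (\<lambda>\<omega>. N t \<omega> - N s \<omega>) = measure_pmf (poisson_pmf (r * (t - s)))"
    using assms by (auto simp: poisson_process_def)
  also have "measure (measure_pmf (poisson_pmf (r * (t - s)))) {0} = exp (- (r * (t - s)))"
    using assms by (simp add: measure_pmf_single)
  finally show ?thesis .
qed

lemma prob_poisson_increment:
  assumes N: "poisson_process M r N" and "0 < r" "0 \<le> s" "s < t"
  shows "prob ((\<lambda>\<omega>. N t \<omega> - N s \<omega>) -` (- {0}) \<inter> space M) = 1 - exp (- (r * (t - s)))"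
proof -
  let ?D = "\<lambda>\<omega>. N t \<omega> - N s \<omega>"
  have "?D -` {0} \<inter> space M \<in> events"
    using poisson_increment_measurable[OF N, of s t] assms by (intro measurable_sets) auto
  moreover have "?D -` (- {0}) \<inter> space M = space M - (?D -` {0} \<inter> space M)" by auto
  ultimately show ?thesis using prob_poisson_no_increment[OF assms] by (simp add: prob_compl)
qed

text \<open>Independence is given for whole paths; an increment is a measurable function of two
  coordinates of the path.\<close>

lemma indep_poisson_increments:
  assumes "indep_poisson_processes M r N" "0 \<le> s" "0 \<le> t"
  shows "indep_vars (\<lambda>_. count_space UNIV) (\<lambda>x \<omega>. N x t \<omega> - N x s \<omega>) UNIV"
proof -
  let ?P = "PiM {0::real..} (\<lambda>_. count_space (UNIV :: nat set))"
  have "(\<lambda>p. p t - p s) \<in> measurable ?P (count_space UNIV)"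
    using assms(2,3) by (intro measurable_diff_count_space measurable_component_singleton) auto
  moreover have "indep_vars (\<lambda>_. ?P) (\<lambda>x \<omega>. \<lambda>t\<in>{0..}. N x t \<omega>) UNIV"
    using assms(1) by (simp add: indep_poisson_processes_def)
  ultimately  have "indep_vars (\<lambda>_. count_space UNIV)
      (\<lambda>x \<omega>. (\<lambda>p. p t - p s) (\<lambda>t\<in>{0..}. N x t \<omega>)) UNIV"
    by (intro indep_vars_compose2[where M' = "\<lambda>_. ?P" and Y = "\<lambda>_ p. p t - p s"
          and X = "\<lambda>x \<omega>. \<lambda>t\<in>{0..}. N x t \<omega>"])
  then show ?thesis using assms(2,3) by simp
qed

lemma AE_poisson_paths:
  assumes "poisson_process M r N"
  shows "AE \<omega> in M. mono_on {0..} (\<lambda>t. N t \<omega>) \<and> cadlag (\<lambda>t. N t \<omega>)"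
  using assms by (auto simp: poisson_process_def)

text \<open>Each clock advances on \<open>[0, T]\<close> with the same probability
  \<open>q < 1\<close>, so by independence any \<open>k\<close> clocks all advance with probability
  \<open>q ^ k\<close>, which tends to 0.\<close>

lemma AE_exists_silent:
  fixes N :: "int \<Rightarrow> real \<Rightarrow> 'a \<Rightarrow> nat"
  assumes N: "indep_poisson_processes M r N" and "0 < r" "0 < T" and "infinite I"
  shows "AE \<omega> in M. \<exists>x\<in>I. silent (\<lambda>t. N x t \<omega>) T"
proof -
  have pp: "poisson_process M r (N x)" for x using N by (simp add: indep_poisson_processes_def)
  define A where "A = (\<lambda>x. (\<lambda>\<omega>. N x T \<omega> - N x 0 \<omega>) -` (- {0}) \<inter> space M)"
  define Z where "Z = (\<Inter>x\<in>I. A x)"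
  define q where "q = 1 - exp (- (r * T))"
  have q: "0 \<le> q" "q < 1" using \<open>0 < r\<close> \<open>0 < T\<close> by (auto simp: q_def)
  have A: "A x \<in> events" for x
    unfolding A_def using poisson_increment_measurable[OF pp, of 0 T] \<open>0 < T\<close>
    by (intro measurable_sets) auto
  have "I \<noteq> {}" using \<open>infinite I\<close> by auto
  have Z: "Z \<in> events"
    unfolding Z_def using A \<open>I \<noteq> {}\<close> by (intro sets.countable_INT') auto
  have "prob Z \<le> q ^ Suc m" for m
  proof -
    \<comment> \<open>The size \<open>Suc m\<close> keeps \<open>J\<close> nonempty, as the product
      rule for intersections requires.\<close>
    obtain J where J: "finite J" "card J = Suc m" "J \<subseteq> I"
      using infinite_arbitrarily_large[OF \<open>infinite I\<close>] by blast
    then have "J \<noteq> {}" by auto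
    have "prob Z \<le> prob (\<Inter>x\<in>J. A x)"
      using J \<open>J \<noteq> {}\<close> A by (intro finite_measure_mono sets.finite_INT) (auto simp: Z_def)
    also have "\<dots> = (\<Prod>x\<in>J. prob (A x))"
      unfolding A_def using J \<open>J \<noteq> {}\<close> \<open>0 < T\<close>
      by (intro indep_varsD[OF indep_poisson_increments[OF N]]) auto
    also have "\<dots> = q ^ Suc m"
      unfolding A_def q_def
      using prob_poisson_increment[OF pp \<open>0 < r\<close> order_refl \<open>0 < T\<close>] J by simp
    finally show ?thesis .
  qed
  moreover have "(\<lambda>m. q ^ Suc m) \<longlonglongrightarrow> 0"
    using q by (intro LIMSEQ_Suc LIMSEQ_realpow_zero) auto
  ultimately have "prob Z \<le> 0"
    by (intro LIMSEQ_le_const[of "\<lambda>m. q ^ Suc m"]) auto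
  then have "Z \<in> null_sets M" using Z by (simp add: null_sets_def emeasure_eq_measure measure_le_0_iff)
  then have "AE \<omega> in M. \<omega> \<notin> Z" by (rule AE_not_in)
  moreover have "AE \<omega> in M. \<forall>x. mono_on {0..} (\<lambda>t. N x t \<omega>) \<and> cadlag (\<lambda>t. N x t \<omega>)"
    using AE_poisson_paths[OF pp] by (simp add: AE_all_countable)
  ultimately show ?thesis using AE_space
  proof eventually_elim
    case (elim \<omega>)
    \<comment> \<open>Subtraction on \<open>nat\<close> is truncated, so a zero difference yields
      only an inequality; this already contradicts the strict increase forced by an event.\<close>
    then obtain x where x: "x \<in> I" "N x T \<omega> \<le> N x 0 \<omega>" unfolding Z_def A_def by fastforce
    have "\<not> event (\<lambda>t. N x t \<omega>) t" if "0 < t" "t \<le> T" for t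
      using event_imp_increment[of "\<lambda>t. N x t \<omega>" t 0 T] elim(2) that x(2) by fastforce
    then show ?case using x(1) by (auto simp: silent_def)
  qed
qed

lemma AE_no_simultaneous_events:
  fixes N :: "'i \<Rightarrow> real \<Rightarrow> 'a \<Rightarrow> nat"
  assumes N: "indep_poisson_processes M r N" and "0 < r" "0 < T" and "x \<noteq> y"
  shows "AE \<omega> in M. \<forall>t. 0 < t \<and> t \<le> T \<longrightarrow> \<not> (event (\<lambda>t. N x t \<omega>) t \<and> event (\<lambda>t. N y t \<omega>) t)"
proof -
  have pp: "poisson_process M r (N x)" for x using N by (simp add: indep_poisson_processes_def)
  \<comment> \<open>Cut \<open>[0, T]\<close> into \<open>m + 1\<close> equal pieces: a simultaneous event forces both clocks to increase in
    one piece, which has probability of order \<open>1 / m\<close>.\<close>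
  define \<tau> where "\<tau> = (\<lambda>m i. T * real i / real (Suc m))"
  define A where "A = (\<lambda>m i z. (\<lambda>\<omega>. N z (\<tau> m (Suc i)) \<omega> - N z (\<tau> m i) \<omega>) -` (- {0}) \<inter> space M)"
  define G where "G = (\<lambda>m. \<Union>i\<in>{..m}. A m i x \<inter> A m i y)"
  define Z where "Z = (\<Inter>m. G m)"
  have \<tau>: "0 \<le> \<tau> m i" "\<tau> m i < \<tau> m (Suc i)" "\<tau> m (Suc i) - \<tau> m i = T / real (Suc m)" for m i
    using \<open>0 < T\<close>
    by (auto simp: \<tau>_def diff_divide_distrib[symmetric] right_diff_distrib[symmetric]
        intro!: divide_strict_right_mono simp del: of_nat_Suc)
  have A: "A m i z \<in> events" for m i z
    unfolding A_def by (rule measurable_sets[OF poisson_increment_measurable[OF pp \<tau>(1) \<tau>(1)]]) simp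
  have G: "G m \<in> events" for m unfolding G_def using A by auto
  have Z: "Z \<in> events" unfolding Z_def using G by auto
  \<comment> \<open>This is \<open>1 - exp (- u) \<le> u\<close> for the mean \<open>u\<close> of
    the increment.\<close>
  have small: "prob (A m i z) \<le> r * T / real (Suc m)" for m i z
  proof -
    have "prob (A m i z) = 1 - exp (- (r * (T / real (Suc m))))"
      unfolding A_def prob_poisson_increment[OF pp \<open>0 < r\<close> \<tau>(1,2)] \<tau>(3) ..
    also have "\<dots> \<le> r * T / real (Suc m)"
      using exp_ge_add_one_self[of "- (r * (T / real (Suc m)))"] by simp
    finally show ?thesis .
  qed
  have "prob Z \<le> (r * T)\<^sup>2 / real (Suc m)" for m
  proof -
    have "prob (A m i x \<inter> A m i y) \<le> (r * T / real (Suc m))\<^sup>2" for i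
    proof -
      have "prob (\<Inter>z\<in>{x, y}. A m i z) = (\<Prod>z\<in>{x, y}. prob (A m i z))"
        unfolding A_def
        by (intro indep_varsD[OF indep_poisson_increments[OF N \<tau>(1) \<tau>(1)]]) auto
      then have "prob (A m i x \<inter> A m i y) = prob (A m i x) * prob (A m i y)"
        using \<open>x \<noteq> y\<close> by simp
      also have "\<dots> \<le> (r * T / real (Suc m)) * (r * T / real (Suc m))"
        using small \<open>0 < r\<close> \<open>0 < T\<close> by (intro mult_mono) auto
      finally show ?thesis by (simp add: power2_eq_square)
    qed
    note pair = this
    have "prob Z \<le> prob (G m)" using G by (intro finite_measure_mono) (auto simp: Z_def)
    also have "\<dots> \<le> (\<Sum>i\<le>m. prob (A m i x \<inter> A m i y))"
      unfolding G_def using A by (intro finite_measure_subadditive_finite) auto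
    also have "\<dots> \<le> (\<Sum>i\<le>m. (r * T / real (Suc m))\<^sup>2)" by (intro sum_mono pair)
    \<comment> \<open>Summing over \<open>Suc m\<close> pieces costs one of the two factors
      \<open>1 / Suc m\<close>.\<close>
    also have "\<dots> = (r * T)\<^sup>2 / real (Suc m)"
      by (simp add: power2_eq_square divide_simps del: of_nat_Suc)
    finally show ?thesis .
  qed
  moreover have "(\<lambda>m. (r * T)\<^sup>2 / real (Suc m)) \<longlonglongrightarrow> 0"
    by (rule LIMSEQ_Suc[OF lim_const_over_n])
  ultimately have "prob Z \<le> 0"
    by (intro LIMSEQ_le_const[of "\<lambda>m. (r * T)\<^sup>2 / real (Suc m)"]) auto
  then have "Z \<in> null_sets M" using Z by (simp add: null_sets_def emeasure_eq_measure measure_le_0_iff)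
  then have "AE \<omega> in M. \<omega> \<notin> Z" by (rule AE_not_in)
  with AE_poisson_paths[OF pp[of x]] AE_poisson_paths[OF pp[of y]] AE_space show ?thesis
  proof eventually_elim
    case (elim \<omega>)
    show ?case
    proof (intro allI impI notI)
      fix t assume t: "0 < t \<and> t \<le> T" and ev: "event (\<lambda>t. N x t \<omega>) t \<and> event (\<lambda>t. N y t \<omega>) t"
      have "\<omega> \<in> G m" for m
      proof -
        define u where "u = t * real (Suc m) / T"
        \<comment> \<open>The pieces are open on the left and closed on the right, hence the ceiling
          minus one: an event at a division point belongs to the piece that ends there. As
          \<open>u > 0\<close>, \<open>nat\<close> truncates nothing.\<close>
        define i where "i = nat (\<lceil>u\<rceil> - 1)"
        have u: "0 < u" "u \<le> real (Suc m)" using t by (auto simp: u_def pos_divide_le_eq mult.commute simp del: of_nat_Suc)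
        then have i: "real i < u" "u \<le> real (Suc i)" "i \<le> m" unfolding i_def by linarith+
        have tu: "t = T * u / real (Suc m)" using \<open>0 < T\<close> by (simp add: u_def del: of_nat_Suc)
        have lt: "\<tau> m i < t" "t \<le> \<tau> m (Suc i)"
          unfolding \<tau>_def tu using i \<open>0 < T\<close>
          by (auto intro!: divide_strict_right_mono divide_right_mono simp del: of_nat_Suc)
        have "\<omega> \<in> A m i x" "\<omega> \<in> A m i y"
          using event_imp_increment[OF _ _ _ \<tau>(1) lt, of "\<lambda>t. N x t \<omega>"]
            event_imp_increment[OF _ _ _ \<tau>(1) lt, of "\<lambda>t. N y t \<omega>"] elim ev
          by (auto simp: A_def)
        then show ?thesis using i(3) by (auto simp: G_def)
      qed
      then show False using elim by (auto simp: Z_def)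
    qed
  qed
qed

end

theorem lemma54:
  fixes M :: "'w measure"
    and N :: "int \<Rightarrow> real \<Rightarrow> 'w \<Rightarrow> nat"
    and \<zeta>0 \<eta>0 :: "int \<Rightarrow> int"
    and \<zeta> \<eta> :: "'w \<Rightarrow> real \<Rightarrow> int \<Rightarrow> int"
    and X :: "'w \<Rightarrow> int \<Rightarrow> real \<Rightarrow> int"
  assumes "prob_space M"
    and "indep_poisson_processes M (1/2) N"
    and "\<zeta>0 \<in> X0"
    and "\<forall>x. \<eta>0 x \<in> {0, 1}"
    and "\<forall>x. 1 - 2 * \<eta>0 x = \<zeta>0 (x + 1) - \<zeta>0 x"
    and "AE \<omega> in M. free_process (\<lambda>x t. N x t \<omega>) \<zeta>0 (\<zeta> \<omega>)"
    and "AE \<omega> in M. exclusion_process (\<lambda>x t. N x t \<omega>) \<eta>0 (\<eta> \<omega>)"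
    and "AE \<omega> in M. \<forall>x. stirring_path (\<lambda>y t. N y t \<omega>) x (X \<omega> x)"
  shows "AE \<omega> in M. \<forall>t\<ge>0.
           (\<forall>x. 1 - 2 * \<eta> \<omega> t x = \<zeta> \<omega> t (x + 1) - \<zeta> \<omega> t x) \<and>
           flux_converges \<eta>0 (X \<omega>) t \<and>
           \<zeta> \<omega> t 0 - \<zeta>0 0 = 2 * flux \<eta>0 (X \<omega>) t"
proof -
  interpret prob_space M by fact
  \<comment> \<open>Integer horizons and integer sites keep the exceptional null sets countable in
    number; \<open>Suc k\<close> makes each horizon positive.\<close>
  have "AE \<omega> in M. \<forall>y. \<forall>k::nat. \<forall>t. 0 < t \<and> t \<le> real (Suc k) \<longrightarrow>
      \<not> (event (\<lambda>t. N y t \<omega>) t \<and> event (\<lambda>t. N (y + 1) t \<omega>) t)"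
    unfolding AE_all_countable
    by (intro allI AE_no_simultaneous_events[OF assms(2)]) auto
  moreover have "AE \<omega> in M. \<forall>K. \<forall>k::nat. \<exists>x\<in>{..K}. silent (\<lambda>t. N x t \<omega>) (real (Suc k))"
    unfolding AE_all_countable
    by (intro allI AE_exists_silent[OF assms(2)]) (auto simp: infinite_Iic)
  moreover have "AE \<omega> in M. \<forall>K. \<forall>k::nat. \<exists>x\<in>{K..}. silent (\<lambda>t. N x t \<omega>) (real (Suc k))"
    unfolding AE_all_countable
    by (intro allI AE_exists_silent[OF assms(2)]) (auto simp: infinite_Ici)
  ultimately show ?thesis using assms(6-8)
  proof eventually_elim
    case (elim \<omega>)
    let ?n = "\<lambda>x t. N x t \<omega>"
    have simult: "\<forall>t>0. \<forall>y. \<not> (event (?n y) t \<and> event (?n (y + 1)) t)"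
    proof (intro allI impI)
      fix t :: real and y assume "0 < t"
      moreover obtain k :: nat where "t \<le> real k" using real_arch_simple by blast
      ultimately show "\<not> (event (?n y) t \<and> event (?n (y + 1)) t)"
        using elim(1)[rule_format, of t k y] by simp
    qed
    show ?case
    proof (intro allI impI)
      fix t :: real assume "0 \<le> t"
      obtain k :: nat where "t \<le> real k" using real_arch_simple by blast
      then have k: "t \<le> real (Suc k)" by simp
      have left: "\<exists>a\<le>K. silent (?n a) t" for K
        using elim(2)[rule_format, of K k] silent_mono[OF _ k] by blast
      have right: "\<exists>b\<ge>K. silent (?n b) t" for K
        using elim(3)[rule_format, of K k] silent_mono[OF _ k] by blast
      have "1 - 2 * \<eta> \<omega> t x = \<zeta> \<omega> t (x + 1) - \<zeta> \<omega> t x" for x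
      proof -
        \<comment> \<open>The block may depend on \<open>x\<close>, \<open>t\<close> and \<omega>,
          since the null set has been fixed beforehand.\<close>
        obtain a b where "a \<le> x" "silent (?n a) t" "x + 1 \<le> b" "silent (?n b) t"
          using left right by blast
        then show ?thesis
          using free_exclusion_gradient[OF elim(4,5) assms(5), of a t b x t] \<open>0 \<le> t\<close> by simp
      qed
      moreover obtain a b where "a \<le> 0" "silent (?n a) t" "0 \<le> b" "silent (?n b) t"
        using left right by blast
      note flux_between_silent_clocks[OF elim(4,5) elim(6)[rule_format] simult assms(5)
          this(2,1,4,3) \<open>0 \<le> t\<close> order_refl]
      ultimately show "(\<forall>x. 1 - 2 * \<eta> \<omega> t x = \<zeta> \<omega> t (x + 1) - \<zeta> \<omega> t x) \<and>
           flux_converges \<eta>0 (X \<omega>) t \<and> \<zeta> \<omega> t 0 - \<zeta>0 0 = 2 * flux \<eta>0 (X \<omega>) t"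
        by blast
    qed
  qed
qed

end
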